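(* Let $\mathbf{m}=0110\,1001\dots$ be the Thue--Morse sequence over $\{0,1\}$, indexed from $0$. Then $$\{(a,b): a\ge0,\ b\ge1,\ \mathbf{m}_{a,b}\sim\mathbf{m}\}=\{(a,b): 0\le a<b=2^j \text{ for some } j\ge0\}.$$
   Context: $\mathbf{m}(n)$ is the parity of the number of $1$s in the binary expansion of $n$ (equivalently $\mathbf{m}(0)=0$, $\mathbf{m}(2n)=\mathbf{m}(n)$, $\mathbf{m}(2n+1)=1-\mathbf{m}(n)$). For a sequence $\sigma$ indexed from $0$, $\sigma_{a,b}(n)=\sigma(a+bn)$. For sequences $\sigma,\tau$ over $\mathbb{Z}/2\mathbb{Z}$, $\sigma\sim\tau$ means $\sigma=\tau+c$ (pointwise) for some constant $c\in\mathbb{Z}/2\mathbb{Z}$. *)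

theory Defs
  imports Main "HOL-Library.Z2"
begin

text \<open>
  Sequences over \<open>\<int>/2\<int>\<close> take values in the two-element field \<^typ>\<open>bit\<close>, not to be confused
  with the predicate \<open>bit n k\<close> (digit \<open>k\<close> of \<open>n\<close> is \<open>1\<close>). Only finitely many digits are \<open>1\<close>,
  see \<open>finite_binary_ones\<close> below, and \<open>of_nat\<close> reduces their number modulo \<open>2\<close>.
\<close>

definition thue_morse :: "nat \<Rightarrow> bit" where
  "thue_morse n = of_nat (card {k. bit n k})"

definition arith_subseq :: "(nat \<Rightarrow> 'a) \<Rightarrow> nat \<Rightarrow> nat \<Rightarrow> nat \<Rightarrow> 'a" where
  "arith_subseq s a b n = s (a + b * n)"

definition seq_sim :: "(nat \<Rightarrow> bit) \<Rightarrow> (nat \<Rightarrow> bit) \<Rightarrow> bool" (infix "\<sim>" 50) where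
  "s \<sim> t \<longleftrightarrow> (\<exists>c. \<forall>n. s n = t n + c)"

lemma finite_binary_ones: "finite {k. bit (n :: nat) k}"
proof (rule finite_subset)
  show "{k. bit n k} \<subseteq> {..<n}"
  proof
    fix k assume "k \<in> {k. bit n k}"
    then have "n div 2 ^ k \<noteq> 0" by (auto simp: bit_iff_odd intro!: Nat.gr0I)
    then have "2 ^ k \<le> n" by (simp add: div_eq_0_iff)
    then show "k \<in> {..<n}" using less_le_trans[OF less_exp] by blast
  qed
qed simp

lemma thue_morse_0: "thue_morse 0 = 0"
  by (simp add: thue_morse_def)

lemma thue_morse_double: "thue_morse (2 * n) = thue_morse n"
proof -
  have "{k. bit (2 * n) k} = Suc ` {k. bit n k}"
    by (auto simp: bit_double_iff image_iff gr0_conv_Suc)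
  then show ?thesis by (simp add: thue_morse_def card_image)
qed

lemma thue_morse_double_Suc: "thue_morse (2 * n + 1) = 1 - thue_morse n"
proof -
  have "bit (2 * n + 1) k \<longleftrightarrow> k = 0 \<or> (\<exists>j. k = Suc j \<and> bit n j)" for k
    by (cases k) (auto simp: bit_0 bit_Suc)
  then have "{k. bit (2 * n + 1) k} = insert 0 (Suc ` {k. bit n k})"
    by auto
  then show ?thesis
    by (simp add: thue_morse_def card_image finite_binary_ones)
qed

end

theory Submission
  imports Defs
begin

text \<open>
  Thue--Morse is additive along disjoint binary blocks:
  \<open>m(s + 2\<^sup>k n) = m(s) + m(n)\<close> for \<open>s < 2\<^sup>k\<close>. This gives one inclusion, and shows that halving \<open>a\<close>
  and \<open>b\<close> preserves the relation when \<open>b\<close> is even. Let \<open>b\<close> be odd with \<open>m(a + b n) = m(n) + c\<close>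
  for all \<open>n\<close>. Substituting \<open>2\<^sup>k n + r\<close> for \<open>n\<close> and cutting \<open>a + b r = 2\<^sup>k q + s\<close> off shows
  \<open>m(q + b n) = m(q) + m(n)\<close>. The value \<open>q = 0\<close> is always attained, and \<open>q = 1\<close> unless
  \<open>(a, b) = (0, 1)\<close>; but with \<open>n = b\<close> these two give \<open>m(b\<^sup>2 + 1) = m(b\<^sup>2) + 1\<close>,
  which is false because \<open>b\<^sup>2\<close> is \<open>1\<close> modulo \<open>4\<close>.
\<close>

lemma bit_add_eq_iff: "x + y = z \<longleftrightarrow> x = z + (y :: Z2.bit)"
  by (cases x; cases y; cases z) simp_all

lemma thue_morse_add_bit:
  assumes "e < 2"
  shows "thue_morse (e + 2 * n) = thue_morse n + of_nat e"
proof -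
  have "e = 0 \<or> e = 1" using assms by auto
  then show ?thesis
    using thue_morse_double[of n] thue_morse_double_Suc[of n]
    by (auto simp: add.commute)
qed

lemma thue_morse_add_block:
  assumes "s < 2 ^ k"
  shows "thue_morse (s + 2 ^ k * n) = thue_morse s + thue_morse n"
  using assms
proof (induction k arbitrary: s)
  case 0
  then show ?case by (simp add: thue_morse_0)
next
  case (Suc k)
  define e u where "e = s mod 2" and "u = s div 2"
  have s: "s = e + 2 * u" and e: "e < 2" by (simp_all add: e_def u_def)
  have "u < 2 ^ k" using Suc.prems by (simp add: u_def)
  have "thue_morse (s + 2 ^ Suc k * n) = thue_morse (e + 2 * (u + 2 ^ k * n))"
    by (simp add: s algebra_simps)
  also have "\<dots> = thue_morse s + thue_morse n"
    unfolding s thue_morse_add_bit[OF e] Suc.IH[OF \<open>u < 2 ^ k\<close>] by (simp only: ac_simps)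
  finally show ?case .
qed

lemma thue_morse_arith_carry:
  assumes eq: "\<And>n. thue_morse (a + b * n) = thue_morse n + c"
    and r: "r < 2 ^ k"
  defines "q \<equiv> (a + b * r) div 2 ^ k"
  shows "thue_morse (q + b * n) = thue_morse q + thue_morse n"
proof -
  define s where "s = (a + b * r) mod 2 ^ k"
  have s: "s < 2 ^ k" by (simp add: s_def)
  have ar: "a + b * r = s + 2 ^ k * q" by (simp add: s_def q_def)
  have shift: "thue_morse (q + b * m) = thue_morse m + (thue_morse r + c + thue_morse s)" for m
  proof -
    have "a + b * (r + 2 ^ k * m) = s + 2 ^ k * (q + b * m)"
      using ar by (simp add: algebra_simps)
    then have "thue_morse s + thue_morse (q + b * m) = thue_morse r + thue_morse m + c"
      using eq[of "r + 2 ^ k * m"] thue_morse_add_block[OF s] thue_morse_add_block[OF r] by simp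
    then show ?thesis using bit_add_eq_iff by (metis add.assoc add.commute)
  qed
  \<comment> \<open>The bracketed constant in \<open>shift\<close> does not depend on
    \<open>m\<close>; \<open>m = 0\<close> identifies it as \<open>thue_morse q\<close>.\<close>
  from shift[of 0] have "thue_morse q = thue_morse r + c + thue_morse s"
    by (simp add: thue_morse_0)
  with shift[of n] show ?thesis by (simp only: add.commute)
qed

text \<open>Steps of length \<open>b < 2 ^ k\<close> cannot jump over the half-open interval from
  \<open>2 ^ k\<close> to \<open>2 ^ (k + 1)\<close>; \<open>r\<close> is the first index whose term
  reaches it.\<close>

lemma obtain_carry_one:
  fixes a b :: nat
  assumes "b \<ge> 1" and "\<not> (a = 0 \<and> b = 1)"
  obtains k r where "r < 2 ^ k" and "(a + b * r) div 2 ^ k = 1"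
proof
  define k where "k = a + b"
  define P :: nat where "P = 2 ^ k"
  define r where "r = (P - a - 1) div b + 1"
  have P: "a + b < P" unfolding P_def k_def by (rule less_exp)
  define d where "d = (P - a - 1) mod b"
  have d: "d < b" using assms(1) by (simp add: d_def)
  have "b * ((P - a - 1) div b) + d = P - a - 1" by (simp add: d_def)
  then have "b * r + d = P - a - 1 + b" by (simp add: r_def algebra_simps)
  then have br: "a + b * r + d + 1 = P + b" using P by linarith
  have "r < P"
  \<comment> \<open>If \<open>b = 1\<close>, then \<open>r = P - a\<close>, which is below
    \<open>P\<close> only because \<open>a > 0\<close>; otherwise
    \<open>2 * r \<le> b * r < 2 * P\<close>.\<close>
  proof (cases "b = 1")
    case True
    then show ?thesis using br d assms(2) by simp
  next
    case False
    then have "2 * r \<le> b * r" using assms(1) by (intro mult_right_mono) auto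
    then show ?thesis using br P by linarith
  qed
  then show "r < 2 ^ k" by (simp add: P_def)
  have "P \<le> a + b * r" "a + b * r < 2 * P" using br d P by linarith+
  then have "(a + b * r) div P = 1" by (intro div_nat_eqI) simp_all
  then show "(a + b * r) div 2 ^ k = 1" by (simp add: P_def)
qed

lemma thue_morse_arith_odd:
  assumes eq: "\<And>n. thue_morse (a + b * n) = thue_morse n + c" and "odd b"
  shows "a = 0 \<and> b = 1"
proof (rule ccontr)
  assume "\<not> (a = 0 \<and> b = 1)"
  moreover from \<open>odd b\<close> have "b \<ge> 1" by (auto elim: oddE)
  ultimately obtain k r where "r < 2 ^ k" "(a + b * r) div 2 ^ k = 1"
    using obtain_carry_one by blast
  then have "thue_morse (1 + b * b) = thue_morse 1 + thue_morse b"
    using thue_morse_arith_carry[OF eq, of r k b] by simp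
  moreover have "thue_morse (b * b) = thue_morse b"
  proof -
    \<comment> \<open>Since \<open>a < 2 ^ a\<close>, the choice \<open>r = 0\<close>,
      \<open>k = a\<close> gives \<open>q = 0\<close>.\<close>
    have "a div 2 ^ a = 0" by simp
    then show ?thesis
      using thue_morse_arith_carry[OF eq, of 0 a b] by (simp add: thue_morse_0)
  qed
  moreover have "thue_morse (1 + b * b) = thue_morse (b * b)"
  proof -
    from \<open>odd b\<close> obtain u where "b = 2 * u + 1" by (auto elim: oddE)
    then obtain y where y: "b * b = 1 + 2 ^ 2 * y"
      by (intro that[of "u * u + u"]) (simp add: algebra_simps)
    \<comment> \<open>The last two binary digits change from 01 to 10, which preserves the number of
      ones.\<close>
    then have "1 + b * b = 2 + 2 ^ 2 * y" by simp
    then show ?thesis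
      using y thue_morse_add_block[of 1 2 y] thue_morse_add_block[of 2 2 y] thue_morse_double[of 1]
      by simp
  qed
  moreover have "thue_morse 1 = 1"
    using thue_morse_double_Suc[of 0] by (simp add: thue_morse_0)
  ultimately show False by (cases "thue_morse b") simp_all
qed

text \<open>Halving \<open>a\<close> drops its last digit \<open>e\<close> and turns
  \<open>c\<close> into \<open>c + of_nat e\<close>, so the induction on \<open>b\<close> leaves
  both \<open>a\<close> and \<open>c\<close> free. It ends at odd \<open>b\<close>, where
  \<open>j = 0\<close>.\<close>

lemma thue_morse_arith_imp_power:
  assumes "b \<ge> 1" and "\<And>n. thue_morse (a + b * n) = thue_morse n + c"
  shows "\<exists>j :: nat. a < b \<and> b = 2 ^ j"
  using assms
proof (induction b arbitrary: a c rule: less_induct)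
  case (less b)
  show ?case
  proof (cases "odd b")
    case True
    then show ?thesis using thue_morse_arith_odd[OF less.prems(2)] by (auto intro: exI[of _ 0])
  next
    case False
    then obtain b' where b: "b = 2 * b'" by (auto elim: evenE)
    define a' e where "a' = a div 2" and "e = a mod 2"
    have a: "a = e + 2 * a'" and e: "e < 2" by (simp_all add: a'_def e_def)
    have "thue_morse (a' + b' * n) = thue_morse n + (c + of_nat e)" for n
    proof -
      have "a + b * n = e + 2 * (a' + b' * n)" by (simp add: a b algebra_simps)
      then have "thue_morse (a' + b' * n) + of_nat e = thue_morse n + c"
        using thue_morse_add_bit[OF e] less.prems(2) by metis
      then show ?thesis unfolding bit_add_eq_iff by (simp only: ac_simps)
    qed
    moreover have "b' < b" "b' \<ge> 1" using less.prems(1) b by auto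
    ultimately obtain j :: nat where "a' < b'" "b' = 2 ^ j"
      using less.IH by blast
    then have "a < b \<and> b = 2 ^ Suc j" using a b e by auto
    then show ?thesis by blast
  qed
qed

theorem mainTheorem6:
  shows "{(a, b). b \<ge> 1 \<and> arith_subseq thue_morse a b \<sim> thue_morse} =
         {(a, b). \<exists>j :: nat. a < b \<and> b = 2 ^ j}"
proof -
  have "b \<ge> 1 \<and> arith_subseq thue_morse a b \<sim> thue_morse \<longleftrightarrow>
      (\<exists>j :: nat. a < b \<and> b = 2 ^ j)" for a b
  proof
    assume "b \<ge> 1 \<and> arith_subseq thue_morse a b \<sim> thue_morse"
    then show "\<exists>j :: nat. a < b \<and> b = 2 ^ j"
      using thue_morse_arith_imp_power by (auto simp: seq_sim_def arith_subseq_def)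
  next
    assume "\<exists>j :: nat. a < b \<and> b = 2 ^ j"
    \<comment> \<open>As \<open>a < 2 ^ j\<close>, block additivity makes
      \<open>thue_morse a\<close> the constant.\<close>
    then show "b \<ge> 1 \<and> arith_subseq thue_morse a b \<sim> thue_morse"
      using thue_morse_add_block
      by (auto simp: seq_sim_def arith_subseq_def add.commute intro!: exI[of _ "thue_morse a"])
  qed
  then show ?thesis by simp
qed

end
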